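(* Let $P$ and $Q$ be nontrivial partially ordered generalized patterns such that $\mathrm{Av}(P)=\mathrm{Av}(Q)$. Then $Q$ can be obtained from $P$ by a succession of additions and removals of single dashes that preserves the set of avoiders at each step; that is, there is a finite sequence of patterns $P=P_0,P_1,\dots,P_r=Q$ such that, for each $i<r$, $P_{i+1}$ is obtained from $P_i$ by adding a single dash or by removing a single dash, and $\mathrm{Av}(P_i)=\mathrm{Av}(P_{i+1})$.
   Context: A permutation of length $n$ is a word containing each element of $\{1,\dots,n\}$ exactly once; $\mathcal{S}$ is the set of all permutations of all lengths $n\ge0$. A partially ordered generalized pattern $P$ is a nonempty word $p_1p_2\dots p_m$ of positive integers (repetitions allowed), whose set of letters is $\{1,2,\dots,r\}$ for some $r$, with a dash written between some of the consecutive letters. An occurrence of $P$ in a permutation $\pi=a_1\dots a_n$ is a subsequence $a_{k_1}\dots a_{k_m}$, $k_1<\dots<k_m$, such that (a) $p_i>p_j$ implies $a_{k_i}>a_{k_j}$ for all $i,j$ (no condition when $p_i=p_j$), and (b) $k_{i+1}=k_i+1$ whenever $p_i$ and $p_{i+1}$ are not separated by a dash. $\mathrm{Av}(P)$ is the set of permutations in $\mathcal{S}$ with no occurrence of $P$. A pattern is nontrivial if it does not consist only of the letter $1$. Adding (removing) a single dash means inserting (deleting) a dash between two consecutive letters that are not (are) currently separated by a dash. *)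

theory Defs
  imports "HOL-Combinatorics.Multiset_Permutations"
begin

definition all_perms :: "nat list set" where
  "all_perms = (\<Union>n. permutations_of_set {1..n})"

(* Positions are counted from 0; i \<in> dashes P means that a dash is written between the
   letters at positions i and i + 1. *)
datatype popattern = POPattern (letters: "nat list") (dashes: "nat set")

definition is_pattern :: "popattern \<Rightarrow> bool" where
  "is_pattern P \<longleftrightarrow> letters P \<noteq> [] \<and> (\<exists>r. set (letters P) = {1..r}) \<and>
     dashes P \<subseteq> {i. i + 1 < length (letters P)}"

definition nontrivial :: "popattern \<Rightarrow> bool" where
  "nontrivial P \<longleftrightarrow> \<not> (\<forall>x \<in> set (letters P). x = 1)"

(* ks is the list of the (0-based) positions in a of the letters of the occurrence. *)
definition occurrence :: "popattern \<Rightarrow> nat list \<Rightarrow> nat list \<Rightarrow> bool" where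
  "occurrence P a ks \<longleftrightarrow>
     length ks = length (letters P) \<and> sorted_wrt (<) ks \<and> set ks \<subseteq> {..<length a} \<and>
     (\<forall>i < length (letters P). \<forall>j < length (letters P).
        letters P ! i > letters P ! j \<longrightarrow> a ! (ks ! i) > a ! (ks ! j)) \<and>
     (\<forall>i. i + 1 < length (letters P) \<and> i \<notin> dashes P \<longrightarrow> ks ! (i + 1) = ks ! i + 1)"

definition Av :: "popattern \<Rightarrow> nat list set" where
  "Av P = {a \<in> all_perms. \<nexists>ks. occurrence P a ks}"

definition adds_dash :: "popattern \<Rightarrow> popattern \<Rightarrow> bool" where
  "adds_dash P Q \<longleftrightarrow>
     (\<exists>i. i + 1 < length (letters P) \<and> i \<notin> dashes P \<and>
          Q = POPattern (letters P) (insert i (dashes P)))"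

definition removes_dash :: "popattern \<Rightarrow> popattern \<Rightarrow> bool" where
  "removes_dash P Q \<longleftrightarrow>
     (\<exists>i. i + 1 < length (letters P) \<and> i \<in> dashes P \<and>
          Q = POPattern (letters P) (dashes P - {i}))"

end

theory Submission
  imports Defs
begin

text \<open>
  The permutations of least length containing a pattern are the linear extensions of the order
  on its letters, so the avoiders determine the letters. For a fixed word it suffices to prove:
  if every permutation that contains the word with a single dash at \<open>i\<close> contains the pattern with
  dash set \<open>D\<close>, then inserting \<open>i\<close> into \<open>D\<close> does not change the avoiders. Applied to each
  dash of \<open>E\<close> in turn, this gives \<open>Av(D) = Av(D \<union> E)\<close> whenever \<open>Av(D) = Av(E)\<close>.

  Inserting one or two suitable values at position \<open>i\<close> into a linear extension shows that the letters
  around \<open>i\<close> are, up to symmetry, the smallest letter \<open>a\<close> followed by the largest letter \<open>b\<close>, that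
  at most one letter of the word lies strictly between them, and that, up to symmetry again,
  either all letters except the \<open>b\<close> at \<open>i + 1\<close> equal \<open>a\<close>, or the dash-free
  block around \<open>i\<close> is \<open>a \<dots> a b\<close>. Conversely, the two halves of a block that is torn apart at \<open>i\<close> can
  be moved together: at the largest value between them in the first case, and in the second case at
  the first value that exceeds all letters other than \<open>b\<close>.
\<close>

section \<open>Embeddings of a word into an integer sequence\<close>

definition emb :: "nat \<Rightarrow> (nat \<Rightarrow> int) \<Rightarrow> nat set \<Rightarrow> nat \<Rightarrow> (nat \<Rightarrow> int) \<Rightarrow> (nat \<Rightarrow> nat) \<Rightarrow> bool" where
  "emb m w D n v k \<longleftrightarrow>
     (\<forall>j<m. k j < n) \<and>
     (\<forall>j. Suc j < m \<longrightarrow> k j < k (Suc j)) \<and>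
     (\<forall>j. Suc j < m \<longrightarrow> j \<notin> D \<longrightarrow> k (Suc j) = Suc (k j)) \<and>
     (\<forall>i<m. \<forall>j<m. w i < w j \<longrightarrow> v (k i) < v (k j))"

definition contains :: "nat \<Rightarrow> (nat \<Rightarrow> int) \<Rightarrow> nat set \<Rightarrow> nat \<Rightarrow> (nat \<Rightarrow> int) \<Rightarrow> bool" where
  "contains m w D n v \<longleftrightarrow> (\<exists>k. emb m w D n v k)"

text \<open>For a fixed word, avoiding \<open>E\<close> then implies avoiding \<open>D\<close>.
  Injective integer sequences stand in for permutations: complementing is negation, and new values
  can be inserted without renumbering.\<close>

definition forces :: "nat \<Rightarrow> (nat \<Rightarrow> int) \<Rightarrow> nat set \<Rightarrow> nat set \<Rightarrow> bool" where
  "forces m w D E \<longleftrightarrow>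
     (\<forall>n v. inj_on v {..<n} \<longrightarrow> contains m w D n v \<longrightarrow> contains m w E n v)"

lemma embI:
  assumes "\<And>j. j < m \<Longrightarrow> k j < n"
    and "\<And>j. Suc j < m \<Longrightarrow> k j < k (Suc j)"
    and "\<And>j. Suc j < m \<Longrightarrow> j \<notin> D \<Longrightarrow> k (Suc j) = Suc (k j)"
    and "\<And>i j. i < m \<Longrightarrow> j < m \<Longrightarrow> w i < w j \<Longrightarrow> v (k i) < v (k j)"
  shows "emb m w D n v k"
  using assms by (auto simp: emb_def)

lemma emb_bound: "emb m w D n v k \<Longrightarrow> j < m \<Longrightarrow> k j < n"
  and emb_step: "emb m w D n v k \<Longrightarrow> Suc j < m \<Longrightarrow> k j < k (Suc j)"
  and emb_adjacent: "emb m w D n v k \<Longrightarrow> Suc j < m \<Longrightarrow> j \<notin> D \<Longrightarrow> k (Suc j) = Suc (k j)"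
  and emb_order: "emb m w D n v k \<Longrightarrow> i < m \<Longrightarrow> j < m \<Longrightarrow> w i < w j \<Longrightarrow> v (k i) < v (k j)"
  by (auto simp: emb_def)

lemma emb_diff:
  assumes "emb m w D n v k" and "i \<le> j" and "j < m"
  shows "k i + (j - i) \<le> k j"
  using assms(2,3)
proof (induction j rule: dec_induct)
  case (step j)
  then show ?case using emb_step[OF assms(1), of j] by linarith
qed simp

lemma emb_less: "emb m w D n v k \<Longrightarrow> i < j \<Longrightarrow> j < m \<Longrightarrow> k i < k j"
  using emb_diff[of m w D n v k i j] by linarith

lemma emb_less_iff: "emb m w D n v k \<Longrightarrow> i < m \<Longrightarrow> j < m \<Longrightarrow> k i < k j \<longleftrightarrow> i < j"
  by (metis emb_less linorder_neqE_nat order_less_asym)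

lemma emb_ge: "emb m w D n v k \<Longrightarrow> j < m \<Longrightarrow> j \<le> k j"
  using emb_diff[of m w D n v k 0 j] by linarith

text \<open>With \<open>emb_ge\<close> this confines letter \<open>j\<close> to the
  \<open>n - m + 1\<close> positions from \<open>j\<close> on; the test sequences below have
  \<open>n - m \<le> 2\<close>.\<close>

lemma emb_le:
  assumes "emb m w D n v k" and "j < m"
  shows "k j + m \<le> n + j"
  using emb_diff[OF assms(1), of j "m - 1"] emb_bound[OF assms(1), of "m - 1"] assms(2) by linarith

lemma emb_block:
  assumes "emb m w D n v k" and "i \<le> j" and "j < m"
    and "\<And>t. i \<le> t \<Longrightarrow> t < j \<Longrightarrow> t \<notin> D"
  shows "k j = k i + (j - i)"
  using assms(2-4)
proof (induction j rule: dec_induct)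
  case (step j)
  then show ?case using emb_adjacent[OF assms(1), of j] by auto
qed simp

lemma emb_cong:
  assumes "\<And>j. j < m \<Longrightarrow> w j = w' j" and "\<And>j. Suc j < m \<Longrightarrow> j \<in> D \<longleftrightarrow> j \<in> D'"
    and "\<And>p. p < n \<Longrightarrow> v p = v' p"
  shows "emb m w D n v k \<longleftrightarrow> emb m w' D' n v' k"
  using assms by (auto simp: emb_def)

lemma contains_cong:
  assumes "\<And>j. j < m \<Longrightarrow> w j = w' j" and "\<And>j. Suc j < m \<Longrightarrow> j \<in> D \<longleftrightarrow> j \<in> D'"
    and "\<And>p. p < n \<Longrightarrow> v p = v' p"
  shows "contains m w D n v \<longleftrightarrow> contains m w' D' n v'"
  using emb_cong[OF assms] by (simp add: contains_def)

lemma contains_mono: "D \<subseteq> E \<Longrightarrow> contains m w D n v \<Longrightarrow> contains m w E n v"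
  unfolding contains_def emb_def by blast

lemma forces_mono: "D \<subseteq> E \<Longrightarrow> forces m w D E"
  by (simp add: forces_def contains_mono)

lemma forces_trans: "forces m w C D \<Longrightarrow> forces m w D E \<Longrightarrow> forces m w C E"
  by (simp add: forces_def)

subsection \<open>Complement and reverse complement\<close>

lemma emb_neg: "emb m (\<lambda>j. - w j) D n (\<lambda>p. - v p) k \<longleftrightarrow> emb m w D n v k"
  by (auto simp: emb_def)

lemma forces_neg: "forces m (\<lambda>j. - w j) D E \<longleftrightarrow> forces m w D E"
proof -
  have *: "forces m (\<lambda>j. - w j) D E" if "forces m w D E" for w :: "nat \<Rightarrow> int"
    unfolding forces_def
  proof (intro allI impI)
    fix n and v :: "nat \<Rightarrow> int"
    assume v: "inj_on v {..<n}" and c: "contains m (\<lambda>j. - w j) D n v"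
    have "inj_on (\<lambda>p. - v p) {..<n}" using v by (simp add: inj_on_def)
    moreover have "contains m w D n (\<lambda>p. - v p)"
      using c emb_neg[of m w D n "\<lambda>p. - v p"] by (simp add: contains_def)
    ultimately have "contains m w E n (\<lambda>p. - v p)" using that by (simp add: forces_def)
    then show "contains m (\<lambda>j. - w j) E n v"
      using emb_neg[of m w E n "\<lambda>p. - v p"] by (simp add: contains_def)
  qed
  show ?thesis using *[of w] *[of "\<lambda>j. - w j"] by auto
qed

text \<open>Reversal turns an ascent at the dash into a descent and negation turns it back, so the
  ascending case is preserved while left and right are exchanged.\<close>

definition rc :: "nat \<Rightarrow> (nat \<Rightarrow> int) \<Rightarrow> nat \<Rightarrow> int" where
  "rc m w j = - w (m - Suc j)"

text \<open>The gap after \<open>j\<close> becomes the gap after \<open>m - 2 - j\<close>. The bound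
  on \<open>j\<close> excludes indices where truncated subtraction would give a spurious 0.\<close>

definition rcd :: "nat \<Rightarrow> nat set \<Rightarrow> nat set" where
  "rcd m D = {j. Suc j < m \<and> m - Suc (Suc j) \<in> D}"

lemma rc_rc: "j < m \<Longrightarrow> rc m (rc m w) j = w j"
  by (simp add: rc_def)

lemma rcd_rcd: "Suc j < m \<Longrightarrow> j \<in> rcd m (rcd m D) \<longleftrightarrow> j \<in> D"
proof -
  assume "Suc j < m"
  then have "m - Suc (Suc (m - Suc (Suc j))) = j" "Suc (m - Suc (Suc j)) < m" by arith+
  then show ?thesis using \<open>Suc j < m\<close> by (simp add: rcd_def)
qed

lemma rcd_insert: "Suc i < m \<Longrightarrow> rcd m (insert i D) = insert (m - Suc (Suc i)) (rcd m D)"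
  by (auto simp: rcd_def)

lemma inj_on_rc:
  assumes "inj_on v {..<n}"
  shows "inj_on (rc n v) {..<n}"
proof (rule inj_onI)
  fix p q assume pq: "p \<in> {..<n}" "q \<in> {..<n}" "rc n v p = rc n v q"
  then have "n - Suc p = n - Suc q" using inj_onD[OF assms] by (simp add: rc_def)
  then show "p = q" using pq by auto
qed

lemma contains_rc:
  assumes "contains m w D n v"
  shows "contains m (rc m w) (rcd m D) n (rc n v)"
proof -
  obtain k where k: "emb m w D n v k" using assms by (auto simp: contains_def)
  have "emb m (rc m w) (rcd m D) n (rc n v) (\<lambda>j. n - Suc (k (m - Suc j)))"
  proof (rule embI)
    fix j assume j: "j < m"
    then show "n - Suc (k (m - Suc j)) < n" using emb_bound[OF k, of "m - Suc j"] by simp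
  next
    fix j assume j: "Suc j < m"
    then obtain d where d: "m = Suc (Suc (j + d))" using less_iff_Suc_add by auto
    show "n - Suc (k (m - Suc j)) < n - Suc (k (m - Suc (Suc j)))"
      using emb_step[OF k, of d] emb_bound[OF k, of "Suc d"] d by simp
    assume "j \<notin> rcd m D"
    then have "d \<notin> D" using d by (simp add: rcd_def)
    then show "n - Suc (k (m - Suc (Suc j))) = Suc (n - Suc (k (m - Suc j)))"
      using emb_adjacent[OF k, of d] emb_bound[OF k, of "Suc d"] d by simp
  next
    fix i j assume ij: "i < m" "j < m" "rc m w i < rc m w j"
    have "n - Suc (n - Suc (k (m - Suc t))) = k (m - Suc t)" if "t < m" for t
      using emb_bound[OF k, of "m - Suc t"] that by simp
    then show "rc n v (n - Suc (k (m - Suc i))) < rc n v (n - Suc (k (m - Suc j)))"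
      using emb_order[OF k, of "m - Suc j" "m - Suc i"] ij by (simp add: rc_def)
  qed
  then show ?thesis by (auto simp: contains_def)
qed

lemma forces_rc: "forces m (rc m w) (rcd m D) (rcd m E) \<longleftrightarrow> forces m w D E"
proof -
  have *: "forces m (rc m w) (rcd m D) (rcd m E)" if f: "forces m w D E" for w D E
    unfolding forces_def
  proof (intro allI impI)
    fix n and v :: "nat \<Rightarrow> int"
    assume v: "inj_on v {..<n}" and c: "contains m (rc m w) (rcd m D) n v"
    have "contains m w D n (rc n v)"
      using contains_rc[OF c] contains_cong[of m "rc m (rc m w)" w "rcd m (rcd m D)" D n "rc n v" "rc n v"]
      by (simp add: rc_rc rcd_rcd)
    then have "contains m w E n (rc n v)"
      using f inj_on_rc[OF v] by (simp add: forces_def)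
    from contains_rc[OF this] show "contains m (rc m w) (rcd m E) n v"
      using contains_cong[of m "rc m w" "rc m w" "rcd m E" "rcd m E" n "rc n (rc n v)" v]
      by (simp add: rc_rc)
  qed
  \<comment> \<open>Both operations are involutions only at indices inside the word, so the double
    application is compared via \<open>contains_cong\<close>.\<close>
  have cong: "contains m (rc m (rc m w)) (rcd m (rcd m D)) n v \<longleftrightarrow> contains m w D n v" for D n v
    by (rule contains_cong) (simp_all add: rc_rc rcd_rcd)
  have "forces m (rc m (rc m w)) (rcd m (rcd m D)) (rcd m (rcd m E)) \<longleftrightarrow> forces m w D E"
    by (simp only: forces_def cong)
  then show ?thesis using *[of w D E] *[of "rc m w" "rcd m D" "rcd m E"] by blast
qed

subsection \<open>Test sequences\<close>

text \<open>For injective \<open>u\<close> these are the linear extensions of the order on the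
  letters.\<close>

definition compatible :: "nat \<Rightarrow> (nat \<Rightarrow> int) \<Rightarrow> (nat \<Rightarrow> int) \<Rightarrow> bool" where
  "compatible m w u \<longleftrightarrow> (\<forall>i<m. \<forall>j<m. w i < w j \<longrightarrow> u i < u j)"

text \<open>
  Letters are ordered by their value and then by position, except that \<open>c\<close> is put above all equal
  letters. The values are even, so that an odd one can be inserted anywhere.
\<close>

definition extension :: "nat \<Rightarrow> (nat \<Rightarrow> int) \<Rightarrow> nat \<Rightarrow> nat \<Rightarrow> int" where
  "extension m w c x = 2 * (w x * (int m + 1) + (if x = c then int m else int x))"

lemma extension_less:
  assumes "x < m" and "y < m" and "w x < w y"
  shows "extension m w c x < extension m w c y"
proof -
  \<comment> \<open>A larger letter gains at least \<open>m + 1\<close>, while the tie-breaking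
    terms differ by at most \<open>m\<close>.\<close>
  have "(w x + 1) * (int m + 1) \<le> w y * (int m + 1)"
    using assms(3) by (intro mult_right_mono) auto
  then have "w x * (int m + 1) + (int m + 1) \<le> w y * (int m + 1)" by (simp add: algebra_simps)
  moreover have "(if x = c then int m else int x) \<le> int m" "0 \<le> (if y = c then int m else int y)"
    using assms(1) by auto
  moreover have "2 * (P + s) < 2 * (Q + t)" if "P + (int m + 1) \<le> Q" "s \<le> int m" "0 \<le> t" for P Q s t :: int
    using that by simp
  ultimately show ?thesis unfolding extension_def by blast
qed

lemma compatible_extension: "compatible m w (extension m w c)"
  by (simp add: compatible_def extension_less)

lemma extension_top:
  assumes "x < m" and "c < m" and "w x \<le> w c" and "x \<noteq> c"
  shows "extension m w c x < extension m w c c"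
proof (cases "w x < w c")
  case False
  then show ?thesis using assms by (simp add: extension_def)
qed (use assms extension_less in blast)

lemma inj_extension: "inj_on (extension m w c) {..<m}"
proof (rule inj_onI)
  fix x y assume xy: "x \<in> {..<m}" "y \<in> {..<m}" and e: "extension m w c x = extension m w c y"
  then have "w x = w y" using extension_less[of x m y w c] extension_less[of y m x w c] by force
  then show "x = y" using e xy by (auto simp: extension_def split: if_splits)
qed

lemma even_extension: "even (extension m w c x)"
  by (simp add: extension_def)

definition ins :: "nat \<Rightarrow> int \<Rightarrow> (nat \<Rightarrow> int) \<Rightarrow> nat \<Rightarrow> int" where
  "ins i z u p = (if p \<le> i then u p else if p = Suc i then z else u (p - 1))"

lemma inj_on_ins:
  assumes "inj_on u {..<m}" and "z \<notin> u ` {..<m}" and "i < m"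
  shows "inj_on (ins i z u) {..<Suc m}"
proof (rule inj_onI)
  fix p q assume pq: "p \<in> {..<Suc m}" "q \<in> {..<Suc m}" "ins i z u p = ins i z u q"
  define g where "g p = (if p \<le> i then p else p - 1)" for p
  have g: "ins i z u p = u (g p) \<and> g p < m" if "p < Suc m" "p \<noteq> Suc i" for p
    using that assms(3) by (auto simp: ins_def g_def)
  have z: "ins i z u (Suc i) = z" by (simp add: ins_def)
  show "p = q"
  proof (cases "p = Suc i \<or> q = Suc i")
    case True
    then show ?thesis using g[of p] g[of q] z pq assms(2) by auto
  next
    case False
    then have "g p = g q" using g[of p] g[of q] pq assms(1) by (auto dest: inj_onD)
    then show ?thesis using False by (auto simp: g_def split: if_splits)
  qed
qed

lemma contains_ins:
  assumes "compatible m w u" and "Suc i < m"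
  shows "contains m w {i} (Suc m) (ins i z u)"
proof -
  have "emb m w {i} (Suc m) (ins i z u) (\<lambda>j. if j \<le> i then j else Suc j)"
    by (rule embI) (use assms in \<open>auto simp: compatible_def ins_def\<close>)
  then show ?thesis by (auto simp: contains_def)
qed

text \<open>The sequence is one entry longer than the word, so letter \<open>i\<close> sits at
  \<open>i\<close> or \<open>Suc i\<close>; in the first case \<open>i \<notin> D\<close> puts
  letter \<open>Suc i\<close> right behind it. Either way one of the two letters is forced onto
  \<open>z\<close>.\<close>

lemma insertion_test:
  assumes "forces m w {i} D" and "i \<notin> D" and "Suc i < m"
    and "inj_on u {..<m}" and "compatible m w u" and "z \<notin> u ` {..<m}"
  obtains k where "emb m w D (Suc m) (ins i z u) k"
    and "k i = Suc i \<or> k i = i \<and> k (Suc i) = Suc i"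
proof -
  have "contains m w D (Suc m) (ins i z u)"
    using assms contains_ins[OF assms(5,3)] inj_on_ins[OF assms(4,6)] by (simp add: forces_def)
  then obtain k where k: "emb m w D (Suc m) (ins i z u) k" by (auto simp: contains_def)
  have "i \<le> k i" "k i \<le> Suc i" using emb_ge[OF k, of i] emb_le[OF k, of i] assms(3) by auto
  then show thesis using that[OF k] emb_adjacent[OF k assms(3,2)] by (cases "k i = i") auto
qed

text \<open>
  If \<open>z\<close> played a smallest letter, then the positions of the larger letters would be
  mapped injectively into themselves without \<open>q\<close>.
\<close>

lemma inserted_not_min:
  assumes k: "emb m w D (Suc m) (ins i z u) k" and "i < m" and p: "p < m" "k p = Suc i"
    and q: "q < m" "w p < w q" "u q < z"
    and low: "\<And>j. j < m \<Longrightarrow> w j \<le> w p \<Longrightarrow> u j < z"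
  shows False
proof -
  define S where "S = {j. j < m \<and> w p < w j}"
  \<comment> \<open>\<open>g\<close> turns a position other than \<open>Suc i\<close> of the longer
    sequence into an index of \<open>u\<close>.\<close>
  define g where "g p = (if p \<le> i then p else p - 1)" for p
  have z: "ins i z u (k p) = z" using p by (simp add: ins_def)
  have *: "k j \<noteq> Suc i \<and> g (k j) \<in> S - {q}" if "j \<in> S" for j
  proof -
    have j: "j < m" "w p < w j" using that by (auto simp: S_def)
    have gr: "z < ins i z u (k j)" using emb_order[OF k p(1) j] z by simp
    then have ne: "k j \<noteq> Suc i" by (auto simp: ins_def)
    have b: "k j < Suc m" using emb_bound[OF k j(1)] .
    have "g (k j) < m" using b ne assms(2) by (auto simp: g_def)
    moreover have "ins i z u (k j) = u (g (k j))" using ne by (auto simp: ins_def g_def)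
    ultimately show ?thesis using gr low[of "g (k j)"] q(3) ne by (force simp: S_def)
  qed
  have inj: "inj_on (\<lambda>j. g (k j)) S"
  proof (rule inj_onI)
    fix x y assume xy: "x \<in> S" "y \<in> S" "g (k x) = g (k y)"
    then have "k x = k y" using *[of x] *[of y] by (auto simp: g_def split: if_splits)
    then show "x = y" using emb_less_iff[OF k, of x y] emb_less_iff[OF k, of y x] xy
      by (auto simp: S_def)
  qed
  have "finite S" by (simp add: S_def)
  moreover have "(\<lambda>j. g (k j)) ` S \<subseteq> S" using * by auto
  ultimately have "(\<lambda>j. g (k j)) ` S = S" using inj by (rule endo_inj_surj)
  moreover have "q \<in> S" using q by (simp add: S_def)
  ultimately obtain j where "j \<in> S" "q = g (k j)" by blast
  then show False using *[of j] by blast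
qed

lemma inserted_not_max:
  assumes k: "emb m w D (Suc m) (ins i z u) k" and "i < m" and "p < m" "k p = Suc i"
    and "q < m" "w q < w p" "z < u q"
    and "\<And>j. j < m \<Longrightarrow> w p \<le> w j \<Longrightarrow> z < u j"
  shows False
proof -
  have "ins i (- z) (\<lambda>x. - u x) = (\<lambda>x. - ins i z u x)" by (auto simp: ins_def)
  then have "emb m (\<lambda>j. - w j) D (Suc m) (ins i (- z) (\<lambda>x. - u x)) k"
    using k by (simp add: emb_neg)
  then show False by (rule inserted_not_min[where q = q]) (use assms in auto)
qed

subsection \<open>Necessary conditions\<close>

text \<open>Insert a new maximum at the dash. Letter \<open>i\<close> or \<open>Suc i\<close> has to
  use it, and a letter above that one would find no larger value.\<close>

lemma max_at_dash:
  assumes f: "forces m w {i} D" and i: "i \<notin> D" "Suc i < m"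
  shows "(\<forall>j<m. w j \<le> w i) \<or> (\<forall>j<m. w j \<le> w (Suc i))"
proof -
  define u where "u = extension m w 0"
  define z where "z = Max (u ` {..<m}) + 1"
  have z: "u j < z" if "j < m" for j
    using Max_ge[of "u ` {..<m}" "u j"] that by (simp add: z_def)
  have "z \<notin> u ` {..<m}" using z by fastforce
  then obtain k where k: "emb m w D (Suc m) (ins i z u) k"
    and c: "k i = Suc i \<or> k i = i \<and> k (Suc i) = Suc i"
    using insertion_test[OF f i, of u z] inj_extension compatible_extension unfolding u_def by blast
  have top: "w j \<le> w p" if "k p = Suc i" "p < m" "j < m" for p j
  proof (rule ccontr)
    assume "\<not> w j \<le> w p"
    then have "z < ins i z u (k j)"
      using emb_order[OF k that(2,3)] that(1) by (simp add: ins_def)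
    moreover have "ins i z u (k j) \<le> z"
    proof (cases "k j \<le> i")
      case False
      then have "k j - 1 < m" using emb_bound[OF k that(3)] by linarith
      then show ?thesis using z[of "k j - 1"] False by (simp add: ins_def)
    qed (use z[of "k j"] i in \<open>simp add: ins_def\<close>)
    ultimately show False by simp
  qed
  show ?thesis using c top i by (metis Suc_lessD)
qed

lemma min_at_dash:
  assumes "forces m w {i} D" and "i \<notin> D" "Suc i < m"
  shows "(\<forall>j<m. w i \<le> w j) \<or> (\<forall>j<m. w (Suc i) \<le> w j)"
  using max_at_dash[of m "\<lambda>j. - w j" i D] assms by (simp add: forces_neg)

text \<open>Given two middle letters, insert \<open>z\<close> between their values. Letter
  \<open>i\<close> cannot use \<open>z\<close>, since too few larger values would remain for the
  letters above it; dually for letter \<open>Suc i\<close>.\<close>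

lemma unique_middle:
  assumes f: "forces m w {i} D" and i: "i \<notin> D" "Suc i < m"
    and q: "q < m" "w i < w q" "w q < w (Suc i)" "q' < m" "w i < w q'" "w q' < w (Suc i)"
  shows "q = q'"
proof -
  have *: False if q: "q < m" "w i < w q" "w q < w (Suc i)" "q' < m" "w i < w q'" "w q' < w (Suc i)"
    and le: "w q \<le> w q'" and ne: "q \<noteq> q'" for q q'
  proof -
    \<comment> \<open>Raising \<open>q'\<close> above its ties gives \<open>u q < u q'\<close> even
      for equal letters; as \<open>u\<close> is even, \<open>u q + 1\<close> is then a new value
      strictly between them.\<close>
    define u where "u = extension m w q'"
    define z where "z = u q + 1"
    have ev: "even (u x)" for x by (simp add: u_def even_extension)
    have ext: "u x < u y" if "x < m" "y < m" "w x < w y" for x y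
      using extension_less[OF that] by (simp add: u_def)
    have "odd z" using ev by (simp add: z_def)
    then have nz: "z \<notin> u ` {..<m}" using ev by auto
    have "u q < u q'" using extension_top[of q m q' w] q le ne by (simp add: u_def)
    moreover have "z \<noteq> u q'" using ev[of q'] \<open>odd z\<close> by auto
    ultimately have z: "u q < z" "z < u q'" by (auto simp: z_def)
    obtain k where k: "emb m w D (Suc m) (ins i z u) k"
      and c: "k i = Suc i \<or> k i = i \<and> k (Suc i) = Suc i"
      using insertion_test[OF f i _ _ nz] inj_extension compatible_extension unfolding u_def by blast
    from c show False
    proof
      assume "k i = Suc i"
      then show False
        using inserted_not_min[OF k, of i q] i q z ext[of _ q] by force
    next
      assume "k i = i \<and> k (Suc i) = Suc i"
      then show False
        using inserted_not_max[OF k, of "Suc i" q'] i q z ext[of q'] by force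
    qed
  qed
  show ?thesis using *[of q q'] *[of q' q] q by (metis linorder_linear)
qed

text \<open>Tested with a new maximum followed by a new minimum inserted at the dash.\<close>

lemma no_double_block:
  assumes f: "forces m w {i} D" and i: "i \<notin> D" and D: "i - 1 \<notin> D" "Suc i \<notin> D"
    and b: "0 < i" "Suc (Suc i) < m"
    and w: "w i < w (Suc i)" "w (i - 1) < w (Suc i)" "w i < w (Suc (Suc i))"
  shows False
proof -
  define u where "u = extension m w 0"
  have inj: "inj_on u {..<m}" and res: "compatible m w u"
    by (auto simp: u_def inj_extension compatible_extension)
  define z where "z = Max (u ` {..<m}) + 1"
  define y where "y = Min (u ` {..<m}) - 1"
  have z: "u j < z" if "j < m" for j
    using Max_ge[of "u ` {..<m}" "u j"] that by (simp add: z_def)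
  have y: "y < u j" if "j < m" for j
  proof -
    have "Min (u ` {..<m}) \<le> u j" by (rule Min_le) (use that in auto)
    then show ?thesis by (simp add: y_def)
  qed
  have yz: "y < z" using y[of i] z[of i] b by simp
  define v where "v = (\<lambda>p. if p \<le> i then u p else if p = Suc i then z else
    if p = Suc (Suc i) then y else u (p - 2))"
  \<comment> \<open>The inner insertion puts \<open>y\<close> at \<open>Suc i\<close>; the outer one
    pushes it to \<open>Suc (Suc i)\<close>.\<close>
  have v': "v = ins i z (ins i y u)" by (auto simp: fun_eq_iff v_def ins_def numeral_2_eq_2)
  have "y \<notin> u ` {..<m}" using y by fastforce
  then have "inj_on (ins i y u) {..<Suc m}" using inj_on_ins[OF inj] b by simp
  moreover have "z \<notin> ins i y u ` {..<Suc m}"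
  proof
    assume "z \<in> ins i y u ` {..<Suc m}"
    then obtain p where p: "p < Suc m" "z = ins i y u p" by auto
    then have "p - 1 < m" using b by linarith
    then show False using p z[of p] z[of "p - 1"] yz b by (auto simp: ins_def split: if_splits)
  qed
  ultimately have "inj_on v {..<Suc (Suc m)}" using inj_on_ins b by (simp add: v')
  moreover have "emb m w {i} (Suc (Suc m)) v (\<lambda>j. if j \<le> i then j else j + 2)"
    by (rule embI) (use res b in \<open>auto simp: compatible_def v_def\<close>)
  ultimately have "contains m w D (Suc (Suc m)) v"
    using f by (auto simp: forces_def contains_def)
  then obtain k where k: "emb m w D (Suc (Suc m)) v k" by (auto simp: contains_def)
  have bnd: "y \<le> v p \<and> v p \<le> z" if p: "p < Suc (Suc m)" for p
  proof -
    consider "p \<le> i" "p < m" | "p = Suc i" | "p = Suc (Suc i)" | "Suc (Suc i) < p" "p - 2 < m"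
      using p b by linarith
    then show ?thesis
      by cases (use y[of p] z[of p] y[of "p - 2"] z[of "p - 2"] yz in \<open>auto simp: v_def\<close>)
  qed
  have kb: "y \<le> v (k j)" "v (k j) \<le> z" if "j < m" for j
    using bnd emb_bound[OF k that] by auto
  have a: "k i = Suc (k (i - 1))" "k (Suc i) = Suc (k i)" "k (Suc (Suc i)) = Suc (k (Suc i))"
    using emb_adjacent[OF k, of "i - 1"] emb_adjacent[OF k, of i] emb_adjacent[OF k, of "Suc i"] i D b
    by auto
  have zy: "v (Suc i) = z" "v (Suc (Suc i)) = y" by (auto simp: v_def)
  have o: "v (k i) < v (k (Suc i))" "v (k (i - 1)) < v (k (Suc i))" "v (k i) < v (k (Suc (Suc i)))"
    using emb_order[OF k] w b by auto
  \<comment> \<open>The letters \<open>i - 1\<close> to \<open>i + 2\<close> occupy consecutive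
    positions, with three possible starts. Each start puts the minimum \<open>y\<close> or the
    maximum \<open>z\<close> on a letter that must lie above, respectively below, another
    one.\<close>
  have "i - 1 \<le> k (i - 1)" "k (i - 1) \<le> Suc i"
    using emb_ge[OF k, of "i - 1"] emb_le[OF k, of "i - 1"] b by auto
  then consider "k (i - 1) = i - 1" | "k (i - 1) = i" | "k (i - 1) = Suc i" using b by linarith
  then show False
  proof cases
    case 1
    then have "v (k (Suc (Suc i))) = y" using a b zy by simp
    then show False using o(3) kb(1)[of i] b by simp
  next
    case 2
    then have "v (k i) = z" using a zy by simp
    then show False using o(1) kb(2)[of "Suc i"] b by simp
  next
    case 3
    then have "v (k (i - 1)) = z" using zy by simp
    then show False using o(2) kb(2)[of "Suc i"] b by simp
  qed
qed

text \<open>Tested with a value between those at \<open>q\<close> and \<open>j - 1\<close>.\<close>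

lemma descent_in_block:
  assumes f: "forces m w {i} D" and i: "Suc i < m"
    and j: "Suc i < j" "j < m" "w j < w (Suc i)" "w (j - 1) = w (Suc i)"
    and block: "\<And>t. i \<le> t \<Longrightarrow> t < j \<Longrightarrow> t \<notin> D"
    and min: "\<And>x. x < m \<Longrightarrow> w i \<le> w x" and max: "\<And>x. x < m \<Longrightarrow> w x \<le> w (Suc i)"
    and q: "q < m" "q \<noteq> j - 1"
  shows "w q = w i"
proof (rule ccontr)
  assume "w q \<noteq> w i"
  then have wq: "w i < w q" using min[OF q(1)] by simp
  define u where "u = extension m w (j - 1)"
  define z where "z = u q + 1"
  have ev: "even (u x)" for x by (simp add: u_def even_extension)
  have ext: "u x < u y" if "x < m" "y < m" "w x < w y" for x y
    using extension_less[OF that] by (simp add: u_def)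
  have "odd z" using ev by (simp add: z_def)
  then have nz: "z \<notin> u ` {..<m}" using ev by auto
  have "u q < u (j - 1)" using extension_top[of q m "j - 1" w] q j max by (simp add: u_def)
  moreover have "z \<noteq> u (j - 1)" using ev[of "j - 1"] \<open>odd z\<close> by auto
  ultimately have z: "u q < z" "z < u (j - 1)" by (auto simp: z_def)
  have iD: "i \<notin> D" using block j by simp
  obtain k where k: "emb m w D (Suc m) (ins i z u) k"
    and c: "k i = Suc i \<or> k i = i \<and> k (Suc i) = Suc i"
    using insertion_test[OF f iD i _ _ nz] inj_extension compatible_extension unfolding u_def by blast
  have "k i \<noteq> Suc i" using inserted_not_min[OF k, of i q] i q wq z ext[of _ q] by force
  then have ki: "k i = i" "k (Suc i) = Suc i" using c by auto
  \<comment> \<open>The block carries letter \<open>j\<close> to position \<open>j\<close>, which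
    holds \<open>u (j - 1)\<close> because of the shift by the insertion. The descent from letter
    \<open>Suc i\<close>, sitting on \<open>z\<close>, then needs
    \<open>u (j - 1) < z\<close>.\<close>
  have "k j = k i + (j - i)" by (rule emb_block[OF k]) (use j block in auto)
  then have "k j = j" using ki j by simp
  then have "u (j - 1) < z"
    using emb_order[OF k j(2) i j(3)] ki j by (simp add: ins_def)
  then show False using z by simp
qed

subsection \<open>Sufficient conditions\<close>

text \<open>The block \<open>l..h\<close> is torn apart at \<open>i\<close>; both halves move so
  that letter \<open>Suc i\<close> lands on \<open>M\<close>. The left half moves right and the
  right half moves left, so they stay clear of the neighbouring blocks, and the dashes at
  \<open>l - 1\<close> and \<open>h\<close> absorb the change. Only the order conditions depend on
  the choice of \<open>M\<close>.\<close>

lemma emb_shift: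
  assumes k: "emb m w (insert i D) n v k" and b: "l \<le> i" "i < h" "h < m"
    and block: "\<And>t. l \<le> t \<Longrightarrow> t < h \<Longrightarrow> t \<noteq> i \<Longrightarrow> t \<notin> D"
    and l: "l = 0 \<or> l - 1 \<in> D" and h: "Suc h = m \<or> h \<in> D"
    and M: "k i < M" "M \<le> k (Suc i)"
    and k': "k' = (\<lambda>j. if l \<le> j \<and> j \<le> h then M + j - Suc i else k j)"
    and order: "\<And>x y. x < m \<Longrightarrow> y < m \<Longrightarrow> w x < w y \<Longrightarrow> v (k' x) < v (k' y)"
  shows "emb m w D n v k'"
proof (rule embI)
  have left: "k i = k j + (i - j)" if "l \<le> j" "j \<le> i" for j
    by (rule emb_block[OF k]) (use that b block in auto)
  have right: "k j = k (Suc i) + (j - Suc i)" if "Suc i \<le> j" "j \<le> h" for j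
    by (rule emb_block[OF k]) (use that b block in auto)
  \<comment> \<open>Hence \<open>Suc i \<le> M\<close>, and the subtraction in \<open>k'\<close> is
    never truncated.\<close>
  have li: "i \<le> k i" using emb_ge[OF k] b by simp
  show "k' j < n" if "j < m" for j
    using emb_bound[OF k that] emb_bound[OF k, of "Suc i"] right[of j] M b k' that
    by (cases "j \<le> i") auto
  show "k' j < k' (Suc j)" if j: "Suc j < m" for j
  proof -
    consider "Suc j < l" | "Suc j = l" | "l \<le> j" "j < h" | "j = h" | "h < j" by linarith
    then show ?thesis
    proof cases
      case 2
      then show ?thesis using left[of l] emb_step[OF k j] M li b k' by auto
    next
      case 4
      then show ?thesis using right[of h] emb_step[OF k j] M li b k' by auto
    qed (use emb_step[OF k j] M li b k' in auto)
  qed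
  show "k' (Suc j) = Suc (k' j)" if j: "Suc j < m" "j \<notin> D" for j
  proof -
    consider "Suc j < l" | "Suc j = l" | "l \<le> j" "j < h" | "j = h" | "h < j" by linarith
    then show ?thesis
    proof cases
      case 3
      then show ?thesis using M li b k' by auto
    qed (use emb_adjacent[OF k, of j] j l h b k' in auto)
  qed
qed (use order in auto)

lemma block_start:
  fixes i :: nat
  obtains l where "l \<le> i" and "\<And>t. l \<le> t \<Longrightarrow> t < i \<Longrightarrow> t \<notin> D" and "l = 0 \<or> l - 1 \<in> D"
proof -
  have "\<exists>l\<le>i. (\<forall>t. l \<le> t \<longrightarrow> t < i \<longrightarrow> t \<notin> D) \<and> (l = 0 \<or> l - 1 \<in> D)" for i :: nat
  proof (induction i)
    case (Suc i)
    show ?case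
    proof (cases "i \<in> D")
      case False
      from Suc obtain l where "l \<le> i" "\<forall>t. l \<le> t \<longrightarrow> t < i \<longrightarrow> t \<notin> D" "l = 0 \<or> l - 1 \<in> D" by auto
      then show ?thesis using False by (intro exI[of _ l]) (auto simp: less_Suc_eq)
    qed (auto intro!: exI[of _ "Suc i"])
  qed auto
  then show thesis using that by blast
qed

lemma block_end:
  fixes i m :: nat and D :: "nat set"
  assumes "i < m"
  obtains h where "i \<le> h" and "h < m" and "\<And>t. i \<le> t \<Longrightarrow> t < h \<Longrightarrow> t \<notin> D" and "Suc h = m \<or> h \<in> D"
proof -
  define h where "h = (LEAST h. i \<le> h \<and> (Suc h = m \<or> h \<in> D))"
  have ex: "i \<le> m - 1 \<and> (Suc (m - 1) = m \<or> m - 1 \<in> D)" using assms by simp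
  have h: "i \<le> h \<and> (Suc h = m \<or> h \<in> D)" unfolding h_def
    by (rule LeastI[of "\<lambda>h. i \<le> h \<and> (Suc h = m \<or> h \<in> D)", OF ex])
  have "h \<le> m - 1" unfolding h_def
    by (rule Least_le[of "\<lambda>h. i \<le> h \<and> (Suc h = m \<or> h \<in> D)", OF ex])
  moreover have "t \<notin> D" if "i \<le> t" "t < h" for t
    using not_less_Least[of t "\<lambda>h. i \<le> h \<and> (Suc h = m \<or> h \<in> D)"] that unfolding h_def by blast
  ultimately show thesis using that[of h] h assms by auto
qed

text \<open>Every order condition compares another letter with letter \<open>Suc i\<close>. After
  the shift to the maximum \<open>M\<close>, each other letter sits in the gap or on an old position
  of a letter other than \<open>Suc i\<close>, hence below \<open>v M\<close>.\<close>

lemma forces_single_max: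
  assumes i: "Suc i < m" and w: "w i < w (Suc i)"
    and single: "\<And>q. q < m \<Longrightarrow> q \<noteq> Suc i \<Longrightarrow> w q = w i"
  shows "forces m w (insert i D) D"
  unfolding forces_def
proof (intro allI impI)
  fix n and v :: "nat \<Rightarrow> int"
  assume v: "inj_on v {..<n}" and "contains m w (insert i D) n v"
  then obtain k where k: "emb m w (insert i D) n v k" by (auto simp: contains_def)
  obtain l where l: "l \<le> i" "\<And>t. l \<le> t \<Longrightarrow> t < i \<Longrightarrow> t \<notin> D" "l = 0 \<or> l - 1 \<in> D"
    using block_start by blast
  obtain h where h: "Suc i \<le> h" "h < m" "\<And>t. Suc i \<le> t \<Longrightarrow> t < h \<Longrightarrow> t \<notin> D" "Suc h = m \<or> h \<in> D"
    using block_end[OF i] by blast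
  have ks: "k i < k (Suc i)" "k (Suc i) < n" using emb_step[OF k i] emb_bound[OF k i] by auto
  \<comment> \<open>The range includes \<open>k (Suc i)\<close>, so \<open>v M\<close> is at least
    the old value of letter \<open>Suc i\<close> and thus above all other letters.\<close>
  then have "Max (v ` {k i<..k (Suc i)}) \<in> v ` {k i<..k (Suc i)}" by (intro Max_in) auto
  then obtain M where M: "k i < M" "M \<le> k (Suc i)" "v M = Max (v ` {k i<..k (Suc i)})" by auto
  have top: "v p < v M" if "k i < p" "p \<le> k (Suc i)" "p \<noteq> M" for p
  proof -
    have "v p \<le> v M" using M(3) that by simp
    moreover have "v p \<noteq> v M" using inj_onD[OF v, of p M] that M ks by auto
    ultimately show ?thesis by simp
  qed
  have topk: "v (k x) < v M" if "x < m" "x \<noteq> Suc i" for x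
  proof -
    have "v (k x) < v (k (Suc i))" using emb_order[OF k that(1) i] single[OF that] w by simp
    then show ?thesis using top[of "k (Suc i)"] ks by fastforce
  qed
  define k' where "k' = (\<lambda>j. if l \<le> j \<and> j \<le> h then M + j - Suc i else k j)"
  have left: "k j = k l + (j - l)" if "l \<le> j" "j \<le> i" for j
    by (rule emb_block[OF k]) (use that i l in auto)
  have right: "k j = k (Suc i) + (j - Suc i)" if "Suc i \<le> j" "j \<le> h" for j
    by (rule emb_block[OF k]) (use that i h in auto)
  have small: "v (k' x) < v M" if x: "x < m" "x \<noteq> Suc i" for x
  proof -
    consider "\<not> (l \<le> x \<and> x \<le> h)" | "l \<le> x" "x \<le> i" | "Suc i < x" "x \<le> h" using x by linarith
    then show ?thesis
    proof cases
      case 1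
      then show ?thesis using topk[OF x] by (auto simp: k'_def)
    next
      case 2
      then have e: "k' x = M + x - Suc i" using h by (simp add: k'_def)
      show ?thesis
      proof (cases "k' x \<le> k i")
        case True
        \<comment> \<open>The letter of the left half that formerly sat at
          \<open>k' x\<close>.\<close>
        define j where "j = i - (k i - k' x)"
        have "k' x = k j" "j \<le> i"
          using left[of i] left[of j] e True 2 M emb_ge[OF k, of i] i by (auto simp: j_def)
        then show ?thesis using topk[of j] i by simp
      next
        case False
        then show ?thesis using top[of "k' x"] e 2 M emb_ge[OF k, of i] i by auto
      qed
    next
      case 3
      then have e: "k' x = M + (x - Suc i)" using l by (simp add: k'_def)
      show ?thesis
      proof (cases "k' x \<le> k (Suc i)")
        case True
        then show ?thesis using top[of "k' x"] e 3 M by auto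
      next
        case False
        define j where "j = Suc i + (k' x - k (Suc i))"
        have "k' x = k j" "Suc i < j" "j \<le> h"
          using right[of j] e False 3 M by (auto simp: j_def)
        then show ?thesis using topk[of j] h by simp
      qed
    qed
  qed
  have "emb m w D n v k'"
  proof (rule emb_shift[OF k l(1) _ h(2) _ l(3) h(4) M(1,2) k'_def])
    show "i < h" using h by simp
    show "t \<notin> D" if "l \<le> t" "t < h" "t \<noteq> i" for t
      using that l(2)[of t] h(3)[of t] by linarith
    fix x y assume xy: "x < m" "y < m" "w x < w y"
    then have "y = Suc i" "x \<noteq> Suc i"
      using single[of x] single[of y] w by (metis order_less_irrefl order_less_asym)+
    then show "v (k' x) < v (k' y)" using small[OF xy(1)] l h by (simp add: k'_def)
  qed
  then show "contains m w D n v" by (auto simp: contains_def)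
qed

text \<open>\<open>M\<close> is the first position after \<open>k i\<close> above all non-maximal
  letters. The moved minimal letters may land in the gap before \<open>M\<close>, where each value
  lies below some non-maximal letter; having at most one middle letter makes this bound
  sufficient.\<close>

lemma forces_first_crossing:
  assumes i: "Suc i < m" and w: "w i < w (Suc i)"
    and min: "\<And>x. x < m \<Longrightarrow> w i \<le> w x" and max: "\<And>x. x < m \<Longrightarrow> w x \<le> w (Suc i)"
    and mid: "\<And>q q'. q < m \<Longrightarrow> w i < w q \<Longrightarrow> w q < w (Suc i) \<Longrightarrow>
      q' < m \<Longrightarrow> w i < w q' \<Longrightarrow> w q' < w (Suc i) \<Longrightarrow> q = q'"
    and l: "l \<le> i" "\<And>t. l \<le> t \<Longrightarrow> t < i \<Longrightarrow> t \<notin> D" "l = 0 \<or> l - 1 \<in> D"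
    and low: "\<And>t. l \<le> t \<Longrightarrow> t \<le> i \<Longrightarrow> w t = w i"
    and h: "Suc (Suc i) = m \<or> Suc i \<in> D"
  shows "forces m w (insert i D) D"
  unfolding forces_def
proof (intro allI impI)
  fix n and v :: "nat \<Rightarrow> int"
  assume v: "inj_on v {..<n}" and "contains m w (insert i D) n v"
  then obtain k where k: "emb m w (insert i D) n v k" by (auto simp: contains_def)
  have ks: "k i < k (Suc i)" "k (Suc i) < n" using emb_step[OF k i] emb_bound[OF k i] by auto
  define high where "high p \<longleftrightarrow> (\<forall>j<m. w j < w (Suc i) \<longrightarrow> v (k j) < v p)" for p
  define M where "M = (LEAST p. k i < p \<and> high p)"
  have ex: "k i < k (Suc i) \<and> high (k (Suc i))" using ks emb_order[OF k _ i] by (auto simp: high_def)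
  have M: "k i < M" "high M" using LeastI[of "\<lambda>p. k i < p \<and> high p", OF ex] by (auto simp: M_def)
  have M2: "M \<le> k (Suc i)" unfolding M_def by (rule Least_le[of "\<lambda>p. k i < p \<and> high p", OF ex])
  have gap: "\<exists>j<m. w j < w (Suc i) \<and> v p < v (k j)" if p: "k i < p" "p < M" for p
  proof -
    have "\<not> high p" using not_less_Least[of p "\<lambda>p. k i < p \<and> high p"] p by (auto simp: M_def)
    then obtain j where j: "j < m" "w j < w (Suc i)" "v p \<le> v (k j)" by (auto simp: high_def)
    \<comment> \<open>No letter is embedded strictly between \<open>k i\<close> and
      \<open>k (Suc i)\<close>, so injectivity makes the inequality strict.\<close>
    have "p \<noteq> k j"
    proof
      assume "p = k j"
      then have "k i < k j" "k j < k (Suc i)" using p M2 by auto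
      then show False using emb_less_iff[OF k, of i j] emb_less_iff[OF k, of j "Suc i"] i j by simp
    qed
    then have "v p \<noteq> v (k j)" using inj_onD[OF v, of p "k j"] emb_bound[OF k j(1)] p M2 ks by auto
    then show ?thesis using j by (intro exI[of _ j]) simp
  qed
  define k' where "k' = (\<lambda>j. if l \<le> j \<and> j \<le> Suc i then M + j - Suc i else k j)"
  have left: "k j = k l + (j - l)" if "l \<le> j" "j \<le> i" for j
    by (rule emb_block[OF k]) (use that i l in auto)
  \<comment> \<open>A moved minimal letter lands in the gap or on the old position of another
    minimal letter of the block.\<close>
  have window: "(k i < k' x \<and> k' x < M) \<or> (\<exists>j. l \<le> j \<and> j \<le> i \<and> k' x = k j)"
    if x: "l \<le> x" "x \<le> i" for x
  proof (cases "k' x \<le> k i")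
    case True
    define j where "j = i - (k i - k' x)"
    have "k' x = M + x - Suc i" using x by (simp add: k'_def)
    then have "k' x = k j" "j \<le> i" "l \<le> j"
      using left[of i] left[of x] left[of j] True x M emb_ge[OF k, of i] i by (auto simp: j_def)
    then show ?thesis by blast
  next
    case False
    then show ?thesis using x M emb_ge[OF k, of i] i by (auto simp: k'_def)
  qed
  have k'_top: "k' (Suc i) = M" using l by (simp add: k'_def)
  have "emb m w D n v k'"
  proof (rule emb_shift[OF k l(1) _ i _ l(3) h M(1) M2 k'_def])
    show "t \<notin> D" if "l \<le> t" "t < Suc i" "t \<noteq> i" for t using that l(2)[of t] by simp
    fix x y assume xy: "x < m" "y < m" "w x < w y"
    have x: "x \<noteq> Suc i" "w x < w (Suc i)" using xy max[of y] by auto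
    have y: "\<not> (l \<le> y \<and> y \<le> i)" "w i < w y" using xy low[of y] min[of x] by auto
    have *: "v (k j) < v (k' y)" if j: "j < m" "w j < w y" for j
    proof (cases "y = Suc i")
      case True
      then show ?thesis using M(2) j k'_top by (simp add: high_def)
    next
      case False
      then show ?thesis using y emb_order[OF k j(1) xy(2) j(2)] by (auto simp: k'_def)
    qed
    show "v (k' x) < v (k' y)"
    proof (cases "l \<le> x \<and> x \<le> i")
      case False
      then have "k' x = k x" using x by (auto simp: k'_def)
      then show ?thesis using *[OF xy(1,3)] by simp
    next
      case True
      then consider "k i < k' x" "k' x < M" | j where "l \<le> j" "j \<le> i" "k' x = k j"
        using window by blast
      then show ?thesis
      proof cases
        case 1
        obtain j where j: "j < m" "w j < w (Suc i)" "v (k' x) < v (k j)" using gap[OF 1] by blast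
        show ?thesis
        proof (cases "w j < w y")
          case True
          then show ?thesis using *[OF j(1)] j by simp
        next
          case False
          \<comment> \<open>Now \<open>j\<close> and \<open>y\<close> are both middle letters, hence
            equal, and the bound by \<open>v (k j)\<close> is the required inequality.\<close>
          then have "w i < w j" "w y < w (Suc i)" using y j by auto
          then have "j = y" using mid j xy y by blast
          moreover have "k' y = k y" using y \<open>w y < w (Suc i)\<close> by (auto simp: k'_def le_Suc_eq)
          ultimately show ?thesis using j by simp
        qed
      next
        case 2
        then show ?thesis using *[of j] low[of j] y i by simp
      qed
    qed
  qed simp
  then show "contains m w D n v" by (auto simp: contains_def)
qed

subsection \<open>Superfluous dashes\<close>

text \<open>The first letter after \<open>Suc i\<close> that differs from the maximum ends a descent
  inside the block. By \<open>descent_in_block\<close> only one letter is then not minimal, which is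
  the situation of \<open>forces_single_max\<close>.\<close>

lemma forces_insert_descent:
  assumes f: "forces m w {i} D" and i: "Suc i < m" and w: "w i < w (Suc i)"
    and min: "\<And>x. x < m \<Longrightarrow> w i \<le> w x" and max: "\<And>x. x < m \<Longrightarrow> w x \<le> w (Suc i)"
    and j: "Suc i < j" "j < m" "w j \<noteq> w (Suc i)"
    and block: "\<And>t. i \<le> t \<Longrightarrow> t < j \<Longrightarrow> t \<notin> D"
  shows "forces m w (insert i D) D"
proof -
  define s where "s = (LEAST j. Suc i < j \<and> w j \<noteq> w (Suc i))"
  have s: "Suc i < s \<and> w s \<noteq> w (Suc i)"
    unfolding s_def by (rule LeastI[of "\<lambda>j. Suc i < j \<and> w j \<noteq> w (Suc i)" j]) (use j in simp)
  have sj: "s \<le> j"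
    unfolding s_def by (rule Least_le[of "\<lambda>j. Suc i < j \<and> w j \<noteq> w (Suc i)" j]) (use j in simp)
  have prev: "w (s - 1) = w (Suc i)"
  proof (cases "s - 1 = Suc i")
    case False
    then have "\<not> (Suc i < s - 1 \<and> w (s - 1) \<noteq> w (Suc i))"
      using not_less_Least[of "s - 1" "\<lambda>j. Suc i < j \<and> w j \<noteq> w (Suc i)"] s unfolding s_def by linarith
    then show ?thesis using s False by linarith
  qed simp
  have "w s < w (Suc i)" using max[of s] s sj j by simp
  then have *: "w q = w i" if "q < m" "q \<noteq> s - 1" for q
    using descent_in_block[OF f i, of s q] s sj j prev block min max that by simp
  \<comment> \<open>Letter \<open>Suc i\<close> is not minimal, so it is the one exception.\<close>
  then have "s - 1 = Suc i" using i w by fastforce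
  then show ?thesis using forces_single_max[OF i w] * by simp
qed

text \<open>A non-maximal letter in the right half of the block gives a descent, a non-minimal one
  in the left half does so after reverse complement. Otherwise \<open>no_double_block\<close> leaves
  one half with a single letter, and \<open>forces_first_crossing\<close> applies directly or
  mirrored.\<close>

lemma forces_insert_oriented:
  assumes f: "forces m w {i} D" and iD: "i \<notin> D" and i: "Suc i < m" and w: "w i < w (Suc i)"
    and min: "\<And>x. x < m \<Longrightarrow> w i \<le> w x" and max: "\<And>x. x < m \<Longrightarrow> w x \<le> w (Suc i)"
  shows "forces m w (insert i D) D"
proof -
  have mid: "q = q'" if "q < m" "w i < w q" "w q < w (Suc i)" "q' < m" "w i < w q'" "w q' < w (Suc i)"
    for q q' using unique_middle[OF f iD i that] .
  obtain l where l: "l \<le> i" "\<And>t. l \<le> t \<Longrightarrow> t < i \<Longrightarrow> t \<notin> D" "l = 0 \<or> l - 1 \<in> D"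
    using block_start by blast
  obtain h where h: "Suc i \<le> h" "h < m" "\<And>t. Suc i \<le> t \<Longrightarrow> t < h \<Longrightarrow> t \<notin> D" "Suc h = m \<or> h \<in> D"
    using block_end[OF i] by blast
  have lD: "t \<notin> D" if "l \<le> t" "t \<le> i" for t using l(2)[of t] that iD by (cases "t = i") auto
  have hD: "t \<notin> D" if "i \<le> t" "t < h" for t using h(3)[of t] that iD by (cases "t = i") auto

  \<comment> \<open>The primed data are the reverse complement; the gap at \<open>i\<close> becomes
    the gap at \<open>i'\<close>.\<close>
  define i' where "i' = m - Suc (Suc i)"
  define w' where "w' = rc m w"
  define D' where "D' = rcd m D"
  have i': "Suc i' < m" "Suc i' = m - Suc i" using i by (auto simp: i'_def)
  have "m - Suc i' = Suc i" "m - Suc (Suc i') = i" using i by (auto simp: i'_def)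
  then have w'_eq: "w' i' = - w (Suc i)" "w' (Suc i') = - w i" by (auto simp: w'_def rc_def)
  have w': "w' i' < w' (Suc i')" using w by (simp add: w'_eq)
  have min': "w' i' \<le> w' x" if "x < m" for x
    using max[of "m - Suc x"] that by (simp add: w'_eq) (simp add: w'_def rc_def)
  have max': "w' x \<le> w' (Suc i')" if "x < m" for x
    using min[of "m - Suc x"] that by (simp add: w'_eq) (simp add: w'_def rc_def)
  have "rcd m {i} = {i'}" using rcd_insert[OF i, of "{}"] by (auto simp: i'_def rcd_def)
  then have f': "forces m w' {i'} D'" using f forces_rc[of m w "{i}" D] by (simp add: w'_def D'_def)
  have goal: "forces m w' (insert i' D') D' \<longleftrightarrow> forces m w (insert i D) D"
    using forces_rc[of m w "insert i D" D] rcd_insert[OF i, of D] by (simp add: w'_def D'_def i'_def)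

  consider j where "Suc i < j" "j \<le> h" "w j \<noteq> w (Suc i)" | j where "l \<le> j" "j < i" "w j \<noteq> w i"
    | "\<And>j. l \<le> j \<Longrightarrow> j \<le> i \<Longrightarrow> w j = w i" "\<And>j. Suc i \<le> j \<Longrightarrow> j \<le> h \<Longrightarrow> w j = w (Suc i)"
    by (metis le_neq_implies_less)
  then show ?thesis
  proof cases
    case 1
    show ?thesis by (rule forces_insert_descent[OF f i w min max 1(1) _ 1(3)]) (use 1 h hD in auto)
  next
    case 2
    define j' where "j' = m - Suc j"
    have "forces m w' (insert i' D') D'"
    proof (rule forces_insert_descent[OF f' i'(1) w' min' max'])
      show "Suc i' < j'" "j' < m" using 2 i by (auto simp: i' j'_def)
      show "w' j' \<noteq> w' (Suc i')" using 2 i unfolding w'_eq by (simp add: w'_def rc_def j'_def)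
      fix t assume t: "i' \<le> t" "t < j'"
      then have "l \<le> m - Suc (Suc t)" "m - Suc (Suc t) \<le> i"
        using 2 i by (auto simp: i'_def j'_def)
      then show "t \<notin> D'" using lD by (simp add: D'_def rcd_def)
    qed
    then show ?thesis by (simp add: goal)
  next
    case 3
    have "l = i \<or> h = Suc i"
    proof (rule ccontr)
      assume "\<not> (l = i \<or> h = Suc i)"
      then have c: "l < i" "Suc i < h" using l h by auto
      have "i - 1 \<notin> D" "Suc i \<notin> D" "0 < i" "Suc (Suc i) < m"
        using c h(2) lD[of "i - 1"] hD[of "Suc i"] by linarith+
      moreover have "w (i - 1) = w i" "w (Suc (Suc i)) = w (Suc i)"
        using c 3(1)[of "i - 1"] 3(2)[of "Suc (Suc i)"] by linarith+
      ultimately show False using no_double_block[OF f iD] w by simp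
    qed
    then show ?thesis
    proof
      assume "h = Suc i"
      then show ?thesis
        using forces_first_crossing[OF i w min max mid l 3(1)] h(4) by blast
    next
      assume li: "l = i"
      define l' where "l' = m - Suc h"
      have "forces m w' (insert i' D') D'"
      proof (rule forces_first_crossing[OF i'(1) w' min' max'])
        fix q q'
        assume "q < m" "w' i' < w' q" "w' q < w' (Suc i')"
          and "q' < m" "w' i' < w' q'" "w' q' < w' (Suc i')"
        then have "m - Suc q = m - Suc q'" "q < m" "q' < m"
          using mid[of "m - Suc q" "m - Suc q'"] unfolding w'_eq by (auto simp: w'_def rc_def)
        then show "q = q'" by linarith
      next
        show "l' \<le> i'" using h by (simp add: l'_def i'_def)
        show "t \<notin> D'" if "l' \<le> t" "t < i'" for t
        proof -
          have "i \<le> m - Suc (Suc t)" "m - Suc (Suc t) < h" using that h by (auto simp: l'_def i'_def)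
          then show ?thesis using hD by (simp add: D'_def rcd_def)
        qed
        \<comment> \<open>The dash after \<open>h\<close>, or the end of the word, becomes the
          boundary before \<open>l'\<close>.\<close>
        show "l' = 0 \<or> l' - 1 \<in> D'"
        proof (cases "Suc h = m")
          case False
          then have "m - Suc (Suc (l' - 1)) = h" "Suc (l' - 1) < m" using h by (auto simp: l'_def)
          then show ?thesis using h(4) False by (simp add: D'_def rcd_def)
        qed (simp add: l'_def)
        show "w' t = w' i'" if "l' \<le> t" "t \<le> i'" for t
        proof -
          have "Suc i \<le> m - Suc t" "m - Suc t \<le> h" using that h i by (auto simp: l'_def i'_def)
          then show ?thesis using 3(2)[of "m - Suc t"] unfolding w'_eq by (simp add: w'_def rc_def)
        qed
        \<comment> \<open>Since \<open>l = i\<close>, the dash at \<open>i - 1\<close>, or the start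
          of the word, ends the mirrored block.\<close>
        show "Suc (Suc i') = m \<or> Suc i' \<in> D'"
        proof (cases "i = 0")
          case False
          then have "m - Suc (Suc (Suc i')) = i - 1" "Suc (Suc i') < m"
            using i by (simp_all add: i'_def)
          then show ?thesis using l(3) li False by (simp add: D'_def rcd_def)
        qed (use i in \<open>simp add: i'\<close>)
      qed
      then show ?thesis by (simp add: goal)
    qed
  qed
qed

text \<open>The two letters at the dash are a minimum and a maximum; a single letter that is both
  would make the word constant. Complementing reduces to the ascending case.\<close>

lemma forces_insert:
  assumes f: "forces m w {i} D" and iD: "i \<notin> D" and i: "Suc i < m"
    and nonconst: "x < m" "y < m" "w x \<noteq> w y"
  shows "forces m w (insert i D) D"
proof -
  have eq: "w x = w y" if "\<forall>j<m. w p \<le> w j" "\<forall>j<m. w j \<le> w p" for p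
    using that nonconst by (metis order_antisym)
  consider "\<forall>j<m. w i \<le> w j" "\<forall>j<m. w j \<le> w (Suc i)" | "\<forall>j<m. w (Suc i) \<le> w j" "\<forall>j<m. w j \<le> w i"
    using max_at_dash[OF f iD i] min_at_dash[OF f iD i] eq nonconst by blast
  then show ?thesis
  proof cases
    case 1
    then have "w i \<noteq> w (Suc i)" using eq[of i] nonconst by auto
    then have "w i < w (Suc i)" using 1 i by (simp add: order_less_le)
    then show ?thesis using forces_insert_oriented[OF f iD i] 1 by blast
  next
    case 2
    then have "w i \<noteq> w (Suc i)" using eq[of i] nonconst by auto
    then have "- w i < - w (Suc i)" using 2 i by (simp add: order_less_le)
    moreover have "forces m (\<lambda>j. - w j) {i} D" using f by (simp add: forces_neg)
    ultimately have "forces m (\<lambda>j. - w j) (insert i D) D"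
      using forces_insert_oriented[of m "\<lambda>j. - w j" i D] iD i 2 by simp
    then show ?thesis by (simp add: forces_neg)
  qed
qed

subsection \<open>Avoidance classes\<close>

definition word :: "popattern \<Rightarrow> nat \<Rightarrow> int" where
  "word P j = int (letters P ! j)"

abbreviation pcontains :: "popattern \<Rightarrow> nat \<Rightarrow> (nat \<Rightarrow> int) \<Rightarrow> bool" where
  "pcontains P \<equiv> contains (length (letters P)) (word P) (dashes P)"

lemma occurrence_iff_contains:
  "(\<exists>ks. occurrence P a ks) \<longleftrightarrow> pcontains P (length a) (\<lambda>p. int (a ! p))"
proof
  assume "\<exists>ks. occurrence P a ks"
  then obtain ks where ks: "occurrence P a ks" ..
  have "emb (length (letters P)) (word P) (dashes P) (length a) (\<lambda>p. int (a ! p)) ((!) ks)"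
  proof (rule embI)
    show "ks ! j < length a" if "j < length (letters P)" for j
    proof -
      have "ks ! j \<in> set ks" using ks that by (simp add: occurrence_def)
      then show ?thesis using ks unfolding occurrence_def by blast
    qed
    show "ks ! j < ks ! Suc j" if "Suc j < length (letters P)" for j
      using ks that sorted_wrt_nth_less[of "(<)" ks j "Suc j"] by (simp add: occurrence_def)
    show "ks ! Suc j = Suc (ks ! j)" if "Suc j < length (letters P)" "j \<notin> dashes P" for j
      using ks that by (simp add: occurrence_def)
    show "int (a ! (ks ! i)) < int (a ! (ks ! j))"
      if "i < length (letters P)" "j < length (letters P)" "word P i < word P j" for i j
      using ks that by (simp add: occurrence_def word_def)
  qed
  then show "pcontains P (length a) (\<lambda>p. int (a ! p))" by (auto simp: contains_def)
next
  let ?m = "length (letters P)"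
  assume "pcontains P (length a) (\<lambda>p. int (a ! p))"
  then obtain k where k: "emb ?m (word P) (dashes P) (length a) (\<lambda>p. int (a ! p)) k"
    by (auto simp: contains_def)
  have "occurrence P a (map k [0..<?m])"
    unfolding occurrence_def
  proof (intro conjI allI impI)
    show "sorted_wrt (<) (map k [0..<?m])"
      using emb_less[OF k] by (auto simp: sorted_wrt_iff_nth_less)
    show "set (map k [0..<?m]) \<subseteq> {..<length a}" using emb_bound[OF k] by auto
    show "a ! (map k [0..<?m] ! j) < a ! (map k [0..<?m] ! i)"
      if "i < ?m" "j < ?m" "letters P ! j < letters P ! i" for i j
      using emb_order[OF k that(2,1)] that by (simp add: word_def)
    show "map k [0..<?m] ! (i + 1) = map k [0..<?m] ! i + 1" if "i + 1 < ?m \<and> i \<notin> dashes P" for i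
      using emb_adjacent[OF k, of i] that by simp
  qed simp
  then show "\<exists>ks. occurrence P a ks" ..
qed

lemma contains_order_cong:
  assumes "\<And>p q. p < n \<Longrightarrow> q < n \<Longrightarrow> v p < v q \<longleftrightarrow> v' p < v' q"
  shows "contains m w D n v \<longleftrightarrow> contains m w D n v'"
proof -
  have "emb m w D n v k \<longleftrightarrow> emb m w D n v' k" for k
  proof
    assume k: "emb m w D n v k"
    show "emb m w D n v' k"
      by (rule embI) (use emb_bound[OF k] emb_step[OF k] emb_adjacent[OF k] emb_order[OF k] assms in auto)
  next
    assume k: "emb m w D n v' k"
    show "emb m w D n v k"
      by (rule embI) (use emb_bound[OF k] emb_step[OF k] emb_adjacent[OF k] emb_order[OF k] assms in auto)
  qed
  then show ?thesis by (simp add: contains_def)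
qed

lemma standardize:
  fixes v :: "nat \<Rightarrow> int"
  assumes "inj_on v {..<n}"
  obtains a where "a \<in> all_perms" and "length a = n"
    and "\<And>p q. p < n \<Longrightarrow> q < n \<Longrightarrow> v p < v q \<longleftrightarrow> a ! p < a ! q"
proof -
  \<comment> \<open>The rank of \<open>v p\<close>, starting at 1 because \<open>p\<close> itself is
    counted.\<close>
  define f where "f p = card {q. q < n \<and> v q \<le> v p}" for p
  have mono: "f p < f q" if "p < n" "q < n" "v p < v q" for p q
  proof -
    have "{r. r < n \<and> v r \<le> v p} \<subseteq> {r. r < n \<and> v r \<le> v q}" using that by auto
    moreover have "q \<in> {r. r < n \<and> v r \<le> v q} - {r. r < n \<and> v r \<le> v p}" using that by simp
    ultimately have "{r. r < n \<and> v r \<le> v p} \<subset> {r. r < n \<and> v r \<le> v q}" by blast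
    then show ?thesis unfolding f_def by (intro psubset_card_mono) auto
  qed
  have iff: "v p < v q \<longleftrightarrow> f p < f q" if "p < n" "q < n" for p q
  proof
    assume "f p < f q"
    then have "\<not> v q < v p" "p \<noteq> q" using mono[of q p] that by auto
    then show "v p < v q" using inj_onD[OF assms, of p q] that by force
  qed (use mono that in simp)
  have inj: "inj_on f {..<n}"
  proof (rule inj_onI)
    fix p q assume pq: "p \<in> {..<n}" "q \<in> {..<n}" "f p = f q"
    then have "\<not> v p < v q" "\<not> v q < v p" using iff by simp_all
    then have "v p = v q" by linarith
    then show "p = q" using inj_onD[OF assms] pq by blast
  qed
  have "f p \<in> {1..n}" if "p < n" for p
  proof -
    have "{p} \<subseteq> {q. q < n \<and> v q \<le> v p}" using that by simp
    then have "card {p} \<le> card {q. q < n \<and> v q \<le> v p}" by (intro card_mono) auto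
    moreover have "card {q. q < n \<and> v q \<le> v p} \<le> card {..<n}" by (rule card_mono) auto
    ultimately show ?thesis by (simp add: f_def)
  qed
  then have "f ` {..<n} \<subseteq> {1..n}" by auto
  then have "f ` {..<n} = {1..n}" using inj by (intro card_subset_eq) (auto simp: card_image)
  then have "map f [0..<n] \<in> permutations_of_set {1..n}"
    using inj by (auto simp: permutations_of_set_def distinct_map atLeast0LessThan)
  then have "map f [0..<n] \<in> all_perms" by (auto simp: all_perms_def)
  then show thesis by (rule that) (use iff in auto)
qed

lemma Av_subset_iff:
  "Av P \<subseteq> Av Q \<longleftrightarrow> (\<forall>n v. inj_on v {..<n} \<longrightarrow> pcontains Q n v \<longrightarrow> pcontains P n v)"
proof
  assume sub: "Av P \<subseteq> Av Q"
  show "\<forall>n v. inj_on v {..<n} \<longrightarrow> pcontains Q n v \<longrightarrow> pcontains P n v"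
  proof (intro allI impI)
    fix n and v :: "nat \<Rightarrow> int"
    assume "inj_on v {..<n}" and Q: "pcontains Q n v"
    then obtain a where a: "a \<in> all_perms" "length a = n"
      and ord: "\<And>p q. p < n \<Longrightarrow> q < n \<Longrightarrow> v p < v q \<longleftrightarrow> a ! p < a ! q"
      using standardize by blast
    have eq: "pcontains R n v \<longleftrightarrow> (\<exists>ks. occurrence R a ks)" for R
      unfolding occurrence_iff_contains a(2) by (rule contains_order_cong) (simp add: ord)
    have "a \<notin> Av Q" using Q eq by (auto simp: Av_def)
    then have "a \<notin> Av P" using sub by blast
    then show "pcontains P n v" using a(1) eq by (auto simp: Av_def)
  qed
next
  assume *: "\<forall>n v. inj_on v {..<n} \<longrightarrow> pcontains Q n v \<longrightarrow> pcontains P n v"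
  show "Av P \<subseteq> Av Q"
  proof
    fix a assume a: "a \<in> Av P"
    then have "distinct a" by (auto simp: Av_def all_perms_def permutations_of_set_def)
    then have "inj_on (\<lambda>p. int (a ! p)) {..<length a}" by (auto simp: inj_on_def nth_eq_iff_index_eq)
    then show "a \<in> Av Q" using * a by (auto simp: Av_def occurrence_iff_contains)
  qed
qed

lemma Av_subset_iff_forces:
  "Av (POPattern L E) \<subseteq> Av (POPattern L D) \<longleftrightarrow> forces (length L) (\<lambda>j. int (L ! j)) D E"
  by (simp add: Av_subset_iff forces_def word_def[abs_def])

section \<open>Recovering the letters from the avoiders\<close>

lemma contains_extension: "contains m w D m (extension m w c)"
proof -
  have "emb m w D m (extension m w c) (\<lambda>j. j)" by (rule embI) (auto simp: extension_less)
  then show ?thesis by (auto simp: contains_def)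
qed

text \<open>In a sequence as long as the word, the only embedding is the identity.\<close>

lemma contains_imp_compatible:
  assumes "contains m w D m u"
  shows "compatible m w u"
proof -
  obtain k where k: "emb m w D m u k" using assms by (auto simp: contains_def)
  have "k j = j" if "j < m" for j using emb_ge[OF k that] emb_le[OF k that] by simp
  then show ?thesis using emb_order[OF k] by (auto simp: compatible_def)
qed

text \<open>A linear extension of \<open>Q\<close> contains \<open>Q\<close>, hence also
  \<open>P\<close>, and so is at least as long as \<open>P\<close>.\<close>

lemma Av_subset_length:
  assumes "Av P \<subseteq> Av Q"
  shows "length (letters P) \<le> length (letters Q)"
proof (cases "letters P = []")
  case False
  have "pcontains P (length (letters Q)) (extension (length (letters Q)) (word Q) 0)"
    using assms contains_extension inj_extension unfolding Av_subset_iff by blast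
  then obtain k where
    "emb (length (letters P)) (word P) (dashes P) (length (letters Q))
       (extension (length (letters Q)) (word Q) 0) k"
    by (auto simp: contains_def)
  from emb_le[OF this, of 0] show ?thesis using False by simp
qed simp

text \<open>If letter \<open>j\<close> of \<open>Q\<close> were not below letter \<open>k\<close>, a
  linear extension of \<open>Q\<close> could put \<open>j\<close> above \<open>k\<close>; it would
  contain \<open>Q\<close> but not \<open>P\<close>.\<close>

lemma Av_subset_order:
  assumes "Av P \<subseteq> Av Q" and len: "length (letters P) = length (letters Q)"
    and jk: "j < length (letters P)" "k < length (letters P)" "word P j < word P k"
  shows "word Q j < word Q k"
proof (rule ccontr)
  let ?m = "length (letters P)"
  let ?u = "extension ?m (word Q) j"
  assume "\<not> word Q j < word Q k"
  then have "?u k < ?u j" using jk by (intro extension_top) auto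
  moreover have "pcontains P ?m ?u"
    using assms(1) contains_extension[of ?m "word Q" _ j] inj_extension[of ?m "word Q" j] len
    unfolding Av_subset_iff by simp
  then have "?u j < ?u k" using contains_imp_compatible jk by (auto simp: compatible_def)
  ultimately show False by simp
qed

text \<open>As \<open>f\<close> takes every value from 1 on, a chain of \<open>f j\<close> strictly
  increasing letters ends in \<open>j\<close>, and \<open>g\<close> increases along it. Used in both
  directions, this identifies the letters of two patterns.\<close>

lemma rank_le:
  fixes f g :: "nat \<Rightarrow> nat"
  assumes f: "f ` {..<m} = {1..r}" and g: "\<And>j. j < m \<Longrightarrow> 1 \<le> g j"
    and less: "\<And>j k. j < m \<Longrightarrow> k < m \<Longrightarrow> f j < f k \<Longrightarrow> g j < g k"
    and "j < m"
  shows "f j \<le> g j"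
  using \<open>j < m\<close>
proof (induction "f j" arbitrary: j rule: less_induct)
  case less
  show ?case
  proof (cases "f j \<le> 1")
    case True
    then show ?thesis using g[OF less.prems] by simp
  next
    case False
    moreover have "f j \<in> {1..r}" using f less.prems by blast
    ultimately have "f j - 1 \<in> f ` {..<m}" using f by auto
    then obtain k where k: "k < m" "f k = f j - 1" by auto
    then have "f k < f j" using False by simp
    then have "f k \<le> g k" "g k < g j"
      using less.hyps[of k] assms(3)[of k j] k(1) less.prems by blast+
    then show ?thesis using k by simp
  qed
qed

lemma Av_eq_imp_letters_eq:
  assumes "is_pattern P" and "is_pattern Q" and "Av P = Av Q"
  shows "letters P = letters Q"
proof -
  have len: "length (letters P) = length (letters Q)"
    using Av_subset_length[of P Q] Av_subset_length[of Q P] assms(3) by simp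
  have le: "letters P ! j \<le> letters Q ! j"
    if P: "is_pattern P" and Q: "is_pattern Q" and eq: "Av P = Av Q"
      and len: "length (letters P) = length (letters Q)" and j: "j < length (letters P)" for P Q j
  proof -
    obtain r r' where r: "set (letters P) = {1..r}" "set (letters Q) = {1..r'}"
      using P Q by (auto simp: is_pattern_def)
    show ?thesis
    proof (rule rank_le[OF _ _ _ j])
      show "(!) (letters P) ` {..<length (letters P)} = {1..r}"
        using r(1) by (auto simp: set_conv_nth)
      show "1 \<le> letters Q ! k" if "k < length (letters P)" for k
        using nth_mem[of k "letters Q"] that r(2) len by auto
      show "letters Q ! i < letters Q ! k"
        if "i < length (letters P)" "k < length (letters P)" "letters P ! i < letters P ! k" for i k
        using Av_subset_order[of P Q i k] eq len that by (simp add: word_def)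
    qed
  qed
  show ?thesis
    using le[of P Q] le[of Q P] assms len by (intro nth_equalityI) (auto intro: order_antisym)
qed

section \<open>Chains of single dash changes\<close>

definition dash_step :: "popattern \<Rightarrow> popattern \<Rightarrow> bool" where
  "dash_step P Q \<longleftrightarrow>
     is_pattern P \<and> is_pattern Q \<and> (adds_dash P Q \<or> removes_dash P Q) \<and> Av P = Av Q"

lemma dash_step_sym: "dash_step P Q \<Longrightarrow> dash_step Q P"
  by (cases P; cases Q) (auto simp: dash_step_def adds_dash_def removes_dash_def)

lemma dash_steps_sym: "dash_step\<^sup>*\<^sup>* P Q \<Longrightarrow> dash_step\<^sup>*\<^sup>* Q P"
  by (induction rule: rtranclp_induct) (auto intro: converse_rtranclp_into_rtranclp dash_step_sym)

text \<open>The dashes of \<open>E\<close> are added one at a time, each leaving the avoiders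
  unchanged by \<open>forces_insert\<close>.\<close>

lemma dash_steps_union:
  assumes "is_pattern (POPattern L D)" and "nontrivial (POPattern L D)"
    and E: "is_pattern (POPattern L E)" and Av: "Av (POPattern L D) = Av (POPattern L E)"
  shows "dash_step\<^sup>*\<^sup>* (POPattern L D) (POPattern L (D \<union> E))"
proof -
  define w where "w j = int (L ! j)" for j
  have bnd: "Suc i < length L" if "i \<in> E" for i using E that by (auto simp: is_pattern_def)
  have "E \<subseteq> {..<length L}" using bnd by fastforce
  then have "finite E" using finite_subset by blast
  obtain r where r: "set L = {1..r}" "L \<noteq> []" using assms(1) by (auto simp: is_pattern_def)
  \<comment> \<open>Nontriviality yields a letter other than 1, and the letter 1 occurs as well, so
    the word is not constant.\<close>
  obtain x where x: "x < length L" "w x \<noteq> 1"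
    using assms(2) by (auto simp: nontrivial_def in_set_conv_nth w_def)
  have "r \<noteq> 0"
  proof
    assume "r = 0"
    then show False using r by simp
  qed
  then have "1 \<in> set L" using r by simp
  then obtain y where y: "y < length L" "w y = 1" by (auto simp: in_set_conv_nth w_def)
  have ED: "forces (length L) w E D" using Av Av_subset_iff_forces[of L D E] by (simp add: w_def[abs_def])
  have "dash_step\<^sup>*\<^sup>* (POPattern L D) (POPattern L (D \<union> S)) \<and> Av (POPattern L (D \<union> S)) = Av (POPattern L D)
      \<and> is_pattern (POPattern L (D \<union> S))"
    if "S \<subseteq> E" "finite S" for S
    using that(2,1)
  proof (induction S rule: finite_induct)
    case (insert i S)
    show ?case
    proof (cases "i \<in> D")
      case True
      then have "D \<union> insert i S = D \<union> S" by auto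
      then show ?thesis using insert by simp
    next
      case False
      then have new: "i \<notin> D \<union> S" using insert by simp
      have i: "Suc i < length L" using bnd insert by simp
      \<comment> \<open>The chain \<open>{i}\<close>, \<open>E\<close>, \<open>D\<close>,
        \<open>D \<union> S\<close> of forcings: the middle link is the equality of avoiders, the
        outer ones are inclusions.\<close>
      have "forces (length L) w {i} E" using insert by (intro forces_mono) simp
      then have "forces (length L) w {i} (D \<union> S)"
        using ED forces_trans forces_mono[of D "D \<union> S"] by blast
      then have "forces (length L) w (insert i (D \<union> S)) (D \<union> S)"
        using forces_insert[OF _ new i x(1) y(1)] x y by simp
      then have "Av (POPattern L (D \<union> S)) \<subseteq> Av (POPattern L (insert i (D \<union> S)))"
        by (simp add: Av_subset_iff_forces w_def[abs_def])
      moreover have "Av (POPattern L (insert i (D \<union> S))) \<subseteq> Av (POPattern L (D \<union> S))"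
        unfolding Av_subset_iff_forces by (rule forces_mono) auto
      ultimately have "Av (POPattern L (insert i (D \<union> S))) = Av (POPattern L (D \<union> S))" by simp
      moreover have "is_pattern (POPattern L (insert i (D \<union> S)))"
        using insert i by (auto simp: is_pattern_def)
      moreover have "adds_dash (POPattern L (D \<union> S)) (POPattern L (insert i (D \<union> S)))"
        using new i by (auto simp: adds_dash_def)
      ultimately show ?thesis using insert
        by (auto simp: dash_step_def intro: rtranclp.rtrancl_into_rtrancl)
    qed
  qed (use assms(1) in simp)
  then show ?thesis using \<open>finite E\<close> by blast
qed

theorem proposition2:
  fixes P Q :: popattern
  assumes "is_pattern P" and "nontrivial P"
    and "is_pattern Q" and "nontrivial Q"
    and "Av P = Av Q"
  shows "\<exists>(r::nat) F. F 0 = P \<and> F r = Q \<and>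
           (\<forall>i\<le>r. is_pattern (F i)) \<and>
           (\<forall>i<r. (adds_dash (F i) (F (i + 1)) \<or> removes_dash (F i) (F (i + 1))) \<and>
                  Av (F i) = Av (F (i + 1)))"
proof -
  obtain L D where P: "P = POPattern L D" by (cases P)
  obtain L' E where Q: "Q = POPattern L' E" by (cases Q)
  have L': "L' = L" using Av_eq_imp_letters_eq[OF assms(1,3,5)] by (simp add: P Q)
  \<comment> \<open>Both patterns reach the union of the dash sets by adding dashes; reversing the
    second chain joins them.\<close>
  have "dash_step\<^sup>*\<^sup>* P (POPattern L (D \<union> E))" "dash_step\<^sup>*\<^sup>* Q (POPattern L (E \<union> D))"
    using assms unfolding P Q L' by (auto intro: dash_steps_union)
  then have "dash_step\<^sup>*\<^sup>* P Q" using dash_steps_sym by (metis Un_commute rtranclp_trans)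
  then obtain r F where F: "F 0 = P" "F r = Q" "\<forall>i<r. dash_step (F i) (F (Suc i))"
    by (auto simp: rtranclp_power relpowp_fun_conv)
  have "is_pattern (F i)" if "i \<le> r" for i
    using F that assms(1) by (cases i) (auto simp: dash_step_def)
  then show ?thesis using F by (intro exI[of _ r] exI[of _ F]) (auto simp: dash_step_def)
qed

end
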